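(* Let $\mathcal{C}$ be a family of finite structures. Then $\mathcal{C}$ has $LFP$-OP if and only if $\mathcal{C}$ has $LFP$-sOP or $LFP$-IP.
   Context: Least fixed-point ($LFP$) logic extends first-order logic by relation variables and the rule: if $\varphi$ is a formula in which an $n$-ary relation variable $S$ occurs only positively, $x$ an $n$-tuple of free variables and $u$ a fresh $n$-tuple, then $[\mathbf{lfp}\,Sx.\varphi](u)$ is a formula (binding $S,x$), which holds iff $u$ lies in the least fixed point of the monotone operator $X\mapsto\{b:\varphi(b;X)\}$ (union of the stages $I^\xi=\Gamma(\bigcup_{\eta<\xi}I^\eta)$). An $LFP$ formula has all relation variables bound. For a partitioned formula $\varphi(x;y)$ and structure $\mathbf{M}$, with $\varphi(M^x;b)=\{a\in M^x:\mathbf{M}\models\varphi(a;b)\}$: - OP($n$): there are $a_1,\dots,a_n\in M^x$, $b_1,\dots,b_n\in M^y$ with $\mathbf{M}\models\varphi(a_i;b_j)\iff i<j$. - sOP($n$): there are $b_1,\dots,b_n\in M^y$ with $\varphi(M^x;b_1)\subsetneq\dots\subsetneq\varphi(M^x;b_n)$. - IP($n$): there are $a_1,\dots,a_n\in M^x$, $b_1,\dots,b_{2^n}\in M^y$ with $\mathbf{M}\models\varphi(a_i;b_j)\iff i\in j$, identifying $\{1,\dots,2^n\}$ with the powerset of $\{1,\dots,n\}$. For $P$ among OP, sOP, IP: $\mathcal{C}$ has $LFP$-$P$ if some $LFP$ formula $\varphi(x;y)$ is such that for every $n<\omega$ there is $\mathbf{M}\in\mathcal{C}$ in which $\varphi$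 has $P(n)$. *)

theory Defs
  imports Main
begin

section \<open>Signatures and structures\<close>

text \<open>A symbol belongs to the signature iff its arity is defined, so purely relational
  signatures are included; constants are the function symbols of arity 0.\<close>

record ('f, 'r) signature =
  fun_arity :: "'f \<Rightarrow> nat option"
  rel_arity :: "'r \<Rightarrow> nat option"

record ('f, 'r, 'a) struct =
  universe :: "'a set"
  fun_interp :: "'f \<Rightarrow> 'a list \<Rightarrow> 'a"
  rel_interp :: "'r \<Rightarrow> 'a list set"

definition tuples :: "('f, 'r, 'a) struct \<Rightarrow> nat \<Rightarrow> 'a list set" where
  "tuples M n = {as. length as = n \<and> set as \<subseteq> universe M}"

text \<open>The value of a function symbol outside the tuples of its arity is irrelevant junk.\<close>

definition is_struct :: "('f, 'r) signature \<Rightarrow> ('f, 'r, 'a) struct \<Rightarrow> bool" where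
  "is_struct L M \<longleftrightarrow>
     universe M \<noteq> {} \<and>
     (\<forall>f n. fun_arity L f = Some n \<longrightarrow> (\<forall>as \<in> tuples M n. fun_interp M f as \<in> universe M)) \<and>
     (\<forall>r n. rel_arity L r = Some n \<longrightarrow> rel_interp M r \<subseteq> tuples M n)"

definition is_finite_struct :: "('f, 'r) signature \<Rightarrow> ('f, 'r, 'a) struct \<Rightarrow> bool" where
  "is_finite_struct L M \<longleftrightarrow> is_struct L M \<and> finite (universe M)"


section \<open>Syntax of least fixed-point logic\<close>

text \<open>Individual variables are natural numbers; a relation variable is a name paired with its
  arity. The remaining connectives and the universal quantifier are the usual classical
  abbreviations. \<open>Lfp S xs \<phi> us\<close> stands for $[\mathbf{lfp}\,S\,xs.\,\phi](us)$.\<close>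

type_synonym var = nat
type_synonym relvar = "nat \<times> nat"

abbreviation arity :: "relvar \<Rightarrow> nat" where
  "arity \<equiv> snd"

datatype 'f tm = Var var | Fun 'f "'f tm list"

datatype ('f, 'r) fm =
    Eq "'f tm" "'f tm"
  | Rel 'r "'f tm list"
  | RelVar relvar "'f tm list"
  | Neg "('f, 'r) fm"
  | Conj "('f, 'r) fm" "('f, 'r) fm"
  | Ex var "('f, 'r) fm"
  | Lfp relvar "var list" "('f, 'r) fm" "var list"

fun fv_tm :: "'f tm \<Rightarrow> var set" where
  "fv_tm (Var v) = {v}"
| "fv_tm (Fun f ts) = \<Union> (fv_tm ` set ts)"

primrec fv :: "('f, 'r) fm \<Rightarrow> var set" where
  "fv (Eq s t) = fv_tm s \<union> fv_tm t"
| "fv (Rel r ts) = \<Union> (fv_tm ` set ts)"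
| "fv (RelVar S ts) = \<Union> (fv_tm ` set ts)"
| "fv (Neg \<phi>) = fv \<phi>"
| "fv (Conj \<phi> \<psi>) = fv \<phi> \<union> fv \<psi>"
| "fv (Ex v \<phi>) = fv \<phi> - {v}"
| "fv (Lfp S xs \<phi> us) = (fv \<phi> - set xs) \<union> set us"

primrec free_relvars :: "('f, 'r) fm \<Rightarrow> relvar set" where
  "free_relvars (Eq s t) = {}"
| "free_relvars (Rel r ts) = {}"
| "free_relvars (RelVar S ts) = {S}"
| "free_relvars (Neg \<phi>) = free_relvars \<phi>"
| "free_relvars (Conj \<phi> \<psi>) = free_relvars \<phi> \<union> free_relvars \<psi>"
| "free_relvars (Ex v \<phi>) = free_relvars \<phi>"
| "free_relvars (Lfp S xs \<phi> us) = free_relvars \<phi> - {S}"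

text \<open>\<open>only_polarity S p \<phi>\<close>: every free occurrence of \<open>S\<close> in \<open>\<phi>\<close> is under an even
  (\<open>p = True\<close>) resp. odd (\<open>p = False\<close>) number of negations.\<close>

primrec only_polarity :: "relvar \<Rightarrow> bool \<Rightarrow> ('f, 'r) fm \<Rightarrow> bool" where
  "only_polarity S p (Eq s t) \<longleftrightarrow> True"
| "only_polarity S p (Rel r ts) \<longleftrightarrow> True"
| "only_polarity S p (RelVar T ts) \<longleftrightarrow> (T = S \<longrightarrow> p)"
| "only_polarity S p (Neg \<phi>) \<longleftrightarrow> only_polarity S (\<not> p) \<phi>"
| "only_polarity S p (Conj \<phi> \<psi>) \<longleftrightarrow> only_polarity S p \<phi> \<and> only_polarity S p \<psi>"
| "only_polarity S p (Ex v \<phi>) \<longleftrightarrow> only_polarity S p \<phi>"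
| "only_polarity S p (Lfp T xs \<phi> us) \<longleftrightarrow> T = S \<or> only_polarity S p \<phi>"

abbreviation occurs_only_positively :: "relvar \<Rightarrow> ('f, 'r) fm \<Rightarrow> bool" where
  "occurs_only_positively S \<phi> \<equiv> only_polarity S True \<phi>"

fun wf_tm :: "('f, 'r) signature \<Rightarrow> 'f tm \<Rightarrow> bool" where
  "wf_tm L (Var v) \<longleftrightarrow> True"
| "wf_tm L (Fun f ts) \<longleftrightarrow> fun_arity L f = Some (length ts) \<and> (\<forall>t \<in> set ts. wf_tm L t)"

text \<open>Besides \<open>xs\<close>, the body of a fixed point may have further free individual and relation
  variables, which act as parameters.\<close>

primrec wf_fm :: "('f, 'r) signature \<Rightarrow> ('f, 'r) fm \<Rightarrow> bool" where
  "wf_fm L (Eq s t) \<longleftrightarrow> wf_tm L s \<and> wf_tm L t"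
| "wf_fm L (Rel r ts) \<longleftrightarrow> rel_arity L r = Some (length ts) \<and> (\<forall>t \<in> set ts. wf_tm L t)"
| "wf_fm L (RelVar S ts) \<longleftrightarrow> length ts = arity S \<and> (\<forall>t \<in> set ts. wf_tm L t)"
| "wf_fm L (Neg \<phi>) \<longleftrightarrow> wf_fm L \<phi>"
| "wf_fm L (Conj \<phi> \<psi>) \<longleftrightarrow> wf_fm L \<phi> \<and> wf_fm L \<psi>"
| "wf_fm L (Ex v \<phi>) \<longleftrightarrow> wf_fm L \<phi>"
| "wf_fm L (Lfp S xs \<phi> us) \<longleftrightarrow>
     wf_fm L \<phi> \<and> occurs_only_positively S \<phi> \<and>
     length xs = arity S \<and> distinct xs \<and>
     length us = arity S \<and> distinct us \<and> set us \<inter> (set xs \<union> fv \<phi>) = {}"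

definition LFP_formula :: "('f, 'r) signature \<Rightarrow> ('f, 'r) fm \<Rightarrow> bool" where
  "LFP_formula L \<phi> \<longleftrightarrow> wf_fm L \<phi> \<and> free_relvars \<phi> = {}"


section \<open>Semantics\<close>

definition upds :: "(var \<Rightarrow> 'a) \<Rightarrow> var list \<Rightarrow> 'a list \<Rightarrow> var \<Rightarrow> 'a" where
  "upds e xs as v = (case map_of (zip xs as) v of Some a \<Rightarrow> a | None \<Rightarrow> e v)"

primrec eval_tm :: "('f, 'r, 'a) struct \<Rightarrow> (var \<Rightarrow> 'a) \<Rightarrow> 'f tm \<Rightarrow> 'a" where
  "eval_tm M e (Var v) = e v"
| "eval_tm M e (Fun f ts) = fun_interp M f (map (eval_tm M e) ts)"

text \<open>\<open>lfp\<close> is the least fixed point in the complete lattice of sets; for well-formed formulas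
  the operator it is applied to is monotone because \<open>S\<close> occurs only positively.\<close>

primrec sat :: "('f, 'r, 'a) struct \<Rightarrow> (var \<Rightarrow> 'a) \<Rightarrow> (relvar \<Rightarrow> 'a list set) \<Rightarrow> ('f, 'r) fm \<Rightarrow> bool"
where
  "sat M e R (Eq s t) \<longleftrightarrow> eval_tm M e s = eval_tm M e t"
| "sat M e R (Rel r ts) \<longleftrightarrow> map (eval_tm M e) ts \<in> rel_interp M r"
| "sat M e R (RelVar S ts) \<longleftrightarrow> map (eval_tm M e) ts \<in> R S"
| "sat M e R (Neg \<phi>) \<longleftrightarrow> \<not> sat M e R \<phi>"
| "sat M e R (Conj \<phi> \<psi>) \<longleftrightarrow> sat M e R \<phi> \<and> sat M e R \<psi>"
| "sat M e R (Ex v \<phi>) \<longleftrightarrow> (\<exists>a \<in> universe M. sat M (e(v := a)) R \<phi>)"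
| "sat M e R (Lfp S xs \<phi> us) \<longleftrightarrow>
     map e us \<in> lfp (\<lambda>X. {b \<in> tuples M (arity S). sat M (upds e xs b) (R(S := X)) \<phi>})"


section \<open>Partitioned formulas and the combinatorial properties\<close>

definition partitioned :: "('f, 'r) fm \<Rightarrow> var list \<Rightarrow> var list \<Rightarrow> bool" where
  "partitioned \<phi> x y \<longleftrightarrow> distinct (x @ y) \<and> fv \<phi> \<subseteq> set (x @ y)"

text \<open>Below, \<open>\<phi>\<close> is a partitioned LFP formula, so the values of the default assignments of
  individual and relation variables are irrelevant.\<close>

definition holds ::
  "('f, 'r, 'a) struct \<Rightarrow> ('f, 'r) fm \<Rightarrow> var list \<Rightarrow> var list \<Rightarrow> 'a list \<Rightarrow> 'a list \<Rightarrow> bool" where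
  "holds M \<phi> x y a b \<longleftrightarrow> sat M (upds (\<lambda>_. undefined) (x @ y) (a @ b)) (\<lambda>_. {}) \<phi>"

definition solutions ::
  "('f, 'r, 'a) struct \<Rightarrow> ('f, 'r) fm \<Rightarrow> var list \<Rightarrow> var list \<Rightarrow> 'a list \<Rightarrow> 'a list set" where
  "solutions M \<phi> x y b = {a \<in> tuples M (length x). holds M \<phi> x y a b}"

definition OP :: "('f, 'r, 'a) struct \<Rightarrow> ('f, 'r) fm \<Rightarrow> var list \<Rightarrow> var list \<Rightarrow> nat \<Rightarrow> bool" where
  "OP M \<phi> x y n \<longleftrightarrow>
     (\<exists>a b. (\<forall>i \<in> {1..n}. a i \<in> tuples M (length x)) \<and>
            (\<forall>j \<in> {1..n}. b j \<in> tuples M (length y)) \<and>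
            (\<forall>i \<in> {1..n}. \<forall>j \<in> {1..n}. holds M \<phi> x y (a i) (b j) \<longleftrightarrow> i < j))"

definition sOP :: "('f, 'r, 'a) struct \<Rightarrow> ('f, 'r) fm \<Rightarrow> var list \<Rightarrow> var list \<Rightarrow> nat \<Rightarrow> bool" where
  "sOP M \<phi> x y n \<longleftrightarrow>
     (\<exists>b. (\<forall>j \<in> {1..n}. b j \<in> tuples M (length y)) \<and>
          (\<forall>j \<in> {1..<n}. solutions M \<phi> x y (b j) \<subset> solutions M \<phi> x y (b (Suc j))))"

text \<open>The parameters \<open>b\<close> are indexed directly by the subsets of \<open>{1..n}\<close>.\<close>

definition IP :: "('f, 'r, 'a) struct \<Rightarrow> ('f, 'r) fm \<Rightarrow> var list \<Rightarrow> var list \<Rightarrow> nat \<Rightarrow> bool" where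
  "IP M \<phi> x y n \<longleftrightarrow>
     (\<exists>a b. (\<forall>i \<in> {1..n}. a i \<in> tuples M (length x)) \<and>
            (\<forall>J \<in> Pow {1..n}. b J \<in> tuples M (length y)) \<and>
            (\<forall>i \<in> {1..n}. \<forall>J \<in> Pow {1..n}. holds M \<phi> x y (a i) (b J) \<longleftrightarrow> i \<in> J))"

definition LFP_has ::
  "(('f, 'r, 'a) struct \<Rightarrow> ('f, 'r) fm \<Rightarrow> var list \<Rightarrow> var list \<Rightarrow> nat \<Rightarrow> bool) \<Rightarrow>
   ('f, 'r) signature \<Rightarrow> ('f, 'r, 'a) struct set \<Rightarrow> bool" where
  "LFP_has P L C \<longleftrightarrow>
     (\<exists>\<phi> x y. LFP_formula L \<phi> \<and> partitioned \<phi> x y \<and> (\<forall>n. \<exists>M \<in> C. P M \<phi> x y n))"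

end

theory Submission
  imports Defs "HOL-Library.Ramsey"
begin

text \<open>
  Suppose \<open>\<phi>(x;y)\<close> has the order property but its opposite \<open>\<phi>(y;x)\<close> does not have IP(\<open>k\<close>). By
  Ramsey's theorem a long ordered sequence of parameters may be assumed homogeneous: the set of
  truth patterns \<open>J \<subseteq> {0,\<dots>,k-1}\<close> realised by points on an increasing \<open>k\<close>-tuple of parameters does
  not depend on the tuple. All final segments are realised by the order property, and some pattern is
  not. Hence there are an unrealised \<open>J\<close> and an \<open>i \<in> J\<close> with \<open>i + 1 \<notin> J\<close> such that moving \<open>i\<close>
  to \<open>i + 1\<close> turns \<open>J\<close> into a realised pattern. Fixing all parameters but the \<open>i\<close>-th and
  \<open>(i+1)\<close>-st, let \<open>\<theta>\<close> prescribe \<open>J\<close> on the fixed ones. Then \<open>\<phi>(x;b) \<and> \<not>\<phi>(x;b') \<and> \<theta>\<close> is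
  inconsistent and \<open>\<not>\<phi>(x;b) \<and> \<phi>(x;b') \<and> \<theta>\<close> is consistent whenever \<open>b\<close> precedes \<open>b'\<close>, so
  \<open>\<phi>(x;b) \<and> \<theta>\<close> defines strictly increasing sets.
\<close>

section \<open>Combinatorics of truth patterns\<close>

text \<open>Strictly increasing \<open>k\<close>-lists stand for \<open>k\<close>-subsets, so this
  is Ramsey's theorem with the colours numbered by \<open>g\<close>. \<open>M\<close> is chosen
  before \<open>F\<close>, which later gives a bound uniform over all structures.\<close>

lemma ramsey_sorted_lists:
  fixes Col :: "'c set"
  assumes "finite Col"
  shows "\<exists>M::nat. \<forall>F. (\<forall>cs. F cs \<in> Col) \<longrightarrow>
    (\<exists>hs c. strict_sorted hs \<and> length hs = m \<and> set hs \<subseteq> {..<M} \<and>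
       (\<forall>cs. strict_sorted cs \<longrightarrow> length cs = k \<longrightarrow> set cs \<subseteq> set hs \<longrightarrow> F cs = c))"
proof -
  define l where "l = card Col"
  obtain g where g: "bij_betw g Col {..<l}"
    using assms ex_bij_betw_finite_nat[of Col] by (auto simp: l_def atLeast0LessThan)
  obtain M :: nat where M: "partn_lst {..<M} (replicate l m) k"
    using ramsey_full by blast
  show ?thesis
  proof (rule exI[of _ M], intro allI impI)
    fix F assume F: "\<forall>cs::nat list. F cs \<in> Col"
    define f where "f = (\<lambda>H. g (F (sorted_list_of_set H)))"
    have "f \<in> nsets {..<M} k \<rightarrow> {..<l}"
      using F g by (auto simp: f_def bij_betw_def)
    then obtain c H where c: "c < l" and H: "H \<in> nsets {..<M} m" "f ` nsets H k \<subseteq> {c}"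
      using M by (force simp: partn_lst_def monochromatic_def)
    have "F cs = inv_into Col g c"
      if "strict_sorted cs" "length cs = k" "set cs \<subseteq> set (sorted_list_of_set H)" for cs
    proof -
      have "finite H" using H by (auto simp: nsets_def)
      then have "set cs \<in> nsets H k"
        using that by (auto simp: nsets_def strict_sorted_iff distinct_card)
      then have "f (set cs) = c" using H by auto
      moreover have "sorted_list_of_set (set cs) = cs"
        using that by (simp add: strict_sorted_iff sorted_list_of_set.idem_if_sorted_distinct)
      ultimately show ?thesis
        using F g by (metis bij_betw_inv_into_left f_def)
    qed
    moreover have "strict_sorted (sorted_list_of_set H)"
      by simp
    moreover have "length (sorted_list_of_set H) = m" "set (sorted_list_of_set H) \<subseteq> {..<M}"
      using H by (auto simp: nsets_def)
    ultimately show "\<exists>hs c. strict_sorted hs \<and> length hs = m \<and> set hs \<subseteq> {..<M} \<and>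
       (\<forall>cs. strict_sorted cs \<longrightarrow> length cs = k \<longrightarrow> set cs \<subseteq> set hs \<longrightarrow> F cs = c)"
      by blast
  qed
qed

lemma final_segment_if_Suc_closed:
  fixes J :: "nat set"
  assumes "J \<subseteq> {..<k}" and "\<And>i. i \<in> J \<Longrightarrow> Suc i < k \<Longrightarrow> Suc i \<in> J"
  shows "\<exists>s\<le>k. J = {s..<k}"
proof (cases "J = {}")
  case True
  then show ?thesis by auto
next
  case False
  define s where "s = (LEAST i. i \<in> J)"
  have s: "s \<in> J" and le: "\<And>i. i \<in> J \<Longrightarrow> s \<le> i"
    using False by (auto simp: s_def intro: LeastI Least_le)
  have "p < k \<longrightarrow> p \<in> J" if "s \<le> p" for p
    using that by (induction p rule: dec_induct) (use s assms in auto)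
  then have "J = {s..<k}" using le assms(1) by auto
  moreover have "s \<le> k" using s assms(1) by auto
  ultimately show ?thesis by blast
qed

text \<open>Among the unrealised patterns take \<open>J\<close> of greatest sum. It is not a final
  segment, so some \<open>i\<close> in \<open>J\<close> can move to a free \<open>Suc i\<close>
  below \<open>k\<close>. The move raises the sum by one, so maximality puts the result into
  \<open>C\<close>.\<close>

lemma missing_pattern_swap:
  fixes C :: "nat set set"
  assumes "\<And>s. s \<le> k \<Longrightarrow> {s..<k} \<in> C" and "J0 \<subseteq> {..<k}" "J0 \<notin> C"
  obtains J i where "J \<subseteq> {..<k}" "J \<notin> C" "i \<in> J" "Suc i < k" "Suc i \<notin> J"
    "insert (Suc i) (J - {i}) \<in> C"
proof -
  have "\<Sum>J \<le> \<Sum>{..<k}" if "J \<subseteq> {..<k}" for J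
    using that by (intro sum_mono2) auto
  then have "\<exists>J. (J \<subseteq> {..<k} \<and> J \<notin> C) \<and> (\<forall>J'. J' \<subseteq> {..<k} \<and> J' \<notin> C \<longrightarrow> \<Sum>J' \<le> \<Sum>J)"
    using assms(2,3) ex_has_greatest_nat[of "\<lambda>J. J \<subseteq> {..<k} \<and> J \<notin> C" J0 "\<lambda>J. \<Sum>J" "Suc (\<Sum>{..<k})"]
    by (auto simp: less_Suc_eq_le)
  then obtain J where J: "J \<subseteq> {..<k}" "J \<notin> C"
    and max: "\<And>J'. J' \<subseteq> {..<k} \<Longrightarrow> J' \<notin> C \<Longrightarrow> \<Sum>J' \<le> \<Sum>J"
    by blast
  obtain i where i: "i \<in> J" "Suc i < k" "Suc i \<notin> J"
    using final_segment_if_Suc_closed[OF J(1)] J(2) assms(1) by metis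
  have fin: "finite J" using J(1) finite_subset by blast
  have "\<Sum>(insert (Suc i) (J - {i})) = Suc i + \<Sum>(J - {i})"
    using i fin by simp
  moreover have "\<Sum>J = i + \<Sum>(J - {i})"
    using i fin by (simp add: sum.remove)
  ultimately have "insert (Suc i) (J - {i}) \<in> C"
    using max[of "insert (Suc i) (J - {i})"] J i by fastforce
  with J i that show thesis by blast
qed

text \<open>\<open>Q\<close> is an arbitrary relation, so that \<open>n\<close> is fixed by
  \<open>k\<close> and \<open>N\<close> before any structure is given. Position \<open>Suc i\<close>
  is left free in the chain: the missing pattern forces the truth value there.\<close>

lemma order_chain_from_missing_pattern:
  fixes k N :: nat
  shows "\<exists>n::nat. \<forall>(Q :: 'a \<Rightarrow> 'b \<Rightarrow> bool) A a b.
    (\<forall>i\<in>{1..n}. a i \<in> A) \<longrightarrow>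
    (\<forall>i\<in>{1..n}. \<forall>j\<in>{1..n}. Q (a i) (b j) \<longleftrightarrow> i < j) \<longrightarrow>
    (\<forall>c. (\<forall>p<k. c p \<in> {1..n}) \<longrightarrow>
       (\<exists>J\<subseteq>{..<k}. \<forall>u\<in>A. \<not> (\<forall>p<k. Q u (b (c p)) \<longleftrightarrow> p \<in> J))) \<longrightarrow>
    (\<exists>J i \<beta>. J \<subseteq> {..<k} \<and> i \<in> J \<and> Suc i < k \<and>
       (\<forall>j p. j \<in> {1..N} \<longrightarrow> p < k \<longrightarrow> \<beta> j p \<in> b ` {1..n}) \<and>
       (\<forall>j\<in>{1..<N}. {u\<in>A. \<forall>p<k. p \<noteq> Suc i \<longrightarrow> (Q u (\<beta> j p) \<longleftrightarrow> p \<in> J)}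
          \<subset> {u\<in>A. \<forall>p<k. p \<noteq> Suc i \<longrightarrow> (Q u (\<beta> (Suc j) p) \<longleftrightarrow> p \<in> J)}))"
proof -
  \<comment> \<open>An increasing \<open>k\<close>-tuple is coloured by the set of patterns realised
    on it. With \<open>N + k\<close> homogeneous points a neighbouring pair can slide through
    \<open>N\<close> places while the other positions stay fixed.\<close>
  have "finite (Pow (Pow {..<k}))" by simp
  from ramsey_sorted_lists[OF this, of "N + k" k]
  obtain M :: nat where M: "\<forall>F. (\<forall>cs. F cs \<in> Pow (Pow {..<k})) \<longrightarrow>
    (\<exists>hs c. strict_sorted hs \<and> length hs = N + k \<and> set hs \<subseteq> {..<M} \<and>
       (\<forall>cs. strict_sorted cs \<longrightarrow> length cs = k \<longrightarrow> set cs \<subseteq> set hs \<longrightarrow> F cs = c))"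
    by blast
  show ?thesis
  proof (rule exI[of _ "Suc M"], intro allI impI)
    fix Q :: "'a \<Rightarrow> 'b \<Rightarrow> bool" and A and a :: "nat \<Rightarrow> 'a" and b :: "nat \<Rightarrow> 'b"
    assume aA: "\<forall>i\<in>{1..Suc M}. a i \<in> A"
      and ab: "\<forall>i\<in>{1..Suc M}. \<forall>j\<in>{1..Suc M}. Q (a i) (b j) \<longleftrightarrow> i < j"
      and missing: "\<forall>c. (\<forall>p<k. c p \<in> {1..Suc M}) \<longrightarrow>
        (\<exists>J\<subseteq>{..<k}. \<forall>u\<in>A. \<not> (\<forall>p<k. Q u (b (c p)) \<longleftrightarrow> p \<in> J))"
    \<comment> \<open>The parameter \<open>b 1\<close> is skipped, so that the full pattern is realised by \<open>a 1\<close>.\<close>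
    define b' where "b' j = b (j + 2)" for j
    define pat where
      "pat cs = {J. J \<subseteq> {..<k} \<and> (\<exists>u\<in>A. \<forall>p<k. Q u (b' (cs ! p)) \<longleftrightarrow> p \<in> J)}" for cs
    have "\<forall>cs. pat cs \<in> Pow (Pow {..<k})" by (auto simp: pat_def)
    then obtain hs C where hs: "strict_sorted hs" "length hs = N + k" "set hs \<subseteq> {..<M}"
      and hom: "\<And>cs. strict_sorted cs \<Longrightarrow> length cs = k \<Longrightarrow> set cs \<subseteq> set hs \<Longrightarrow> pat cs = C"
      using M[THEN spec, of pat] by blast
    have hs_lt: "hs ! q < M" if "q < N + k" for q
      using hs(2,3) that by (metis lessThan_iff nth_mem subsetD)
    have hs_less: "hs ! p < hs ! q" if "p < q" "q < N + k" for p q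
      using hs(1,2) that by (simp add: sorted_wrt_iff_nth_less)
    have pat_eq: "pat (map (\<lambda>p. hs ! c p) [0..<k]) = C"
      if "\<And>p. p < k \<Longrightarrow> c p < N + k" "\<And>p q. p < q \<Longrightarrow> q < k \<Longrightarrow> c p < c q" for c
    proof (rule hom)
      show "strict_sorted (map (\<lambda>p. hs ! c p) [0..<k])"
        using that hs_less by (auto simp: sorted_wrt_iff_nth_less)
      show "set (map (\<lambda>p. hs ! c p) [0..<k]) \<subseteq> set hs"
        using that hs(2) by auto
    qed simp
    have id_pat: "pat (map (\<lambda>p. hs ! p) [0..<k]) = C"
      by (rule pat_eq) auto
    have up: "{s..<k} \<in> C" if "s \<le> k" for s
    proof -
      \<comment> \<open>As \<open>b'\<close> shifts indices by 2,
        \<open>Q (a (hs ! s + 1)) (b' (hs ! p))\<close> means \<open>hs ! s \<le> hs ! p\<close>,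
        that is \<open>s \<le> p\<close>. For \<open>s = k\<close> the point
        \<open>a (M + 1)\<close> is related to none of these parameters.\<close>
      define i where "i = (if s < k then hs ! s else M) + 1"
      have i: "i \<in> {1..Suc M}"
        using hs_lt[of s] by (auto simp: i_def)
      have "Q (a i) (b' (hs ! p)) \<longleftrightarrow> p \<in> {s..<k}" if p: "p < k" for p
      proof -
        have pM: "hs ! p < M" using hs_lt p by simp
        then have "Q (a i) (b' (hs ! p)) \<longleftrightarrow> i < hs ! p + 2"
          using ab i by (auto simp: b'_def)
        moreover have "hs ! s \<le> hs ! p \<longleftrightarrow> s \<le> p" if "s < k"
          using hs_less[of s p] hs_less[of p s] p that by (cases s p rule: linorder_cases) auto
        ultimately show ?thesis
          using p pM by (auto simp: i_def)
      qed
      then have "{s..<k} \<in> pat (map (\<lambda>p. hs ! p) [0..<k])"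
        using aA i by (auto simp: pat_def intro!: bexI[of _ "a i"])
      then show ?thesis using id_pat by simp
    qed
    have "\<forall>p<k. hs ! p + 2 \<in> {1..Suc M}"
      using hs_lt by (simp add: Suc_le_eq)
    from missing[THEN spec, THEN mp, OF this]
    obtain J0 where "J0 \<subseteq> {..<k}"
      and "\<forall>u\<in>A. \<not> (\<forall>p<k. Q u (b (hs ! p + 2)) \<longleftrightarrow> p \<in> J0)"
      by blast
    then have "J0 \<subseteq> {..<k}" "J0 \<notin> C"
      unfolding id_pat[symmetric] by (auto simp: pat_def b'_def)
    then obtain J i where J: "J \<subseteq> {..<k}" "J \<notin> C" "i \<in> J" "Suc i < k" "Suc i \<notin> J"
      "insert (Suc i) (J - {i}) \<in> C"
      using missing_pattern_swap up by metis
    \<comment> \<open>Stage \<open>j\<close> puts the pair \<open>i\<close>, \<open>Suc i\<close> on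
      the neighbouring homogeneous indices \<open>i + j\<close>, \<open>i + j + 1\<close>. Smaller
      positions stay put; larger ones lie beyond the reach of the pair, from
      \<open>N + i + 2\<close> on.\<close>
    define c where "c j p = (if p < i then p else if p = i then i + j else if p = Suc i then Suc (i + j)
      else N + p)" for j p :: nat
    define \<beta> where "\<beta> j p = b' (hs ! c j p)" for j p
    have c_lt: "c j p < N + k" if "j \<le> N" "p < k" for j p
      using that J(4) by (auto simp: c_def)
    have c_mono: "c j p < c j q" if "j < N" "p < q" "q < k" for j p q
      using that by (auto simp: c_def)
    have realised: "K \<in> C \<longleftrightarrow> (\<exists>u\<in>A. \<forall>p<k. Q u (\<beta> j p) \<longleftrightarrow> p \<in> K)"
      if "j < N" "K \<subseteq> {..<k}" for j K
    proof -
      have "pat (map (\<lambda>p. hs ! c j p) [0..<k]) = C"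
        using that c_lt c_mono by (intro pat_eq) auto
      then show ?thesis using that by (auto simp: pat_def \<beta>_def)
    qed
    define S where "S j = {u\<in>A. \<forall>p<k. p \<noteq> Suc i \<longrightarrow> (Q u (\<beta> j p) \<longleftrightarrow> p \<in> J)}" for j
    \<comment> \<open>The right member of the pair at stage \<open>j\<close> is the left member at
      stage \<open>Suc j\<close>; the other constrained positions keep their parameters.\<close>
    have shift: "\<beta> (Suc j) p = (if p = i then \<beta> j (Suc i) else \<beta> j p)" if "p \<noteq> Suc i" for j p
      using that by (auto simp: \<beta>_def c_def)
    have S_Suc: "u \<in> S (Suc j) \<longleftrightarrow>
      u \<in> A \<and> Q u (\<beta> j (Suc i)) \<and> (\<forall>p<k. p \<noteq> i \<longrightarrow> p \<noteq> Suc i \<longrightarrow> (Q u (\<beta> j p) \<longleftrightarrow> p \<in> J))" for u j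
      using J(3,4) by (auto simp: S_def shift)
    have "S j \<subset> S (Suc j)" if "j \<in> {1..<N}" for j
    proof
      have j: "j < N" using that by simp
      show "S j \<subseteq> S (Suc j)"
      proof
        fix u assume u: "u \<in> S j"
        \<comment> \<open>Otherwise \<open>u\<close> would realise the unrealised pattern
          \<open>J\<close> at stage \<open>j\<close>.\<close>
        have "Q u (\<beta> j (Suc i))"
          using realised[OF j J(1)] J(2,5) u by (auto simp: S_def)
        then show "u \<in> S (Suc j)" using u unfolding S_Suc by (simp add: S_def)
      qed
      \<comment> \<open>A point realising the swapped pattern witnesses strictness: it is unrelated
        to \<open>\<beta> j i\<close> but related to \<open>\<beta> j (Suc i)\<close>.\<close>
      have "insert (Suc i) (J - {i}) \<subseteq> {..<k}" using J by auto
      then obtain u where u: "u \<in> A"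
        "\<And>p. p < k \<Longrightarrow> Q u (\<beta> j p) \<longleftrightarrow> p \<in> insert (Suc i) (J - {i})"
        using realised[OF j] J(6) by blast
      have "\<not> Q u (\<beta> j i)" using u(2)[of i] J(4) by simp
      moreover have "Q u (\<beta> j i)" if "u \<in> S j" using that J(3,4) by (simp add: S_def)
      ultimately have "u \<notin> S j" by blast
      moreover have "u \<in> S (Suc j)" using u J(4) by (auto simp: S_Suc)
      ultimately show "S j \<noteq> S (Suc j)" by blast
    qed
    moreover have "\<beta> j p \<in> b ` {1..Suc M}" if "j \<in> {1..N}" "p < k" for j p
      using hs_lt[OF c_lt[of j p]] that by (auto simp: \<beta>_def b'_def)
    ultimately show "\<exists>J i \<beta>. J \<subseteq> {..<k} \<and> i \<in> J \<and> Suc i < k \<and>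
       (\<forall>j p. j \<in> {1..N} \<longrightarrow> p < k \<longrightarrow> \<beta> j p \<in> b ` {1..Suc M}) \<and>
       (\<forall>j\<in>{1..<N}. {u\<in>A. \<forall>p<k. p \<noteq> Suc i \<longrightarrow> (Q u (\<beta> j p) \<longleftrightarrow> p \<in> J)}
          \<subset> {u\<in>A. \<forall>p<k. p \<noteq> Suc i \<longrightarrow> (Q u (\<beta> (Suc j) p) \<longleftrightarrow> p \<in> J)})"
      using J(1,3,4) unfolding S_def
      by (intro exI[of _ J] exI[of _ i] exI[of _ \<beta>] conjI allI impI ballI) assumption+
  qed
qed

section \<open>Renaming of individual variables\<close>

text \<open>Bound variables are renamed too, so an injective renaming cannot cause capture.\<close>

primrec rename_tm :: "(var \<Rightarrow> var) \<Rightarrow> 'f tm \<Rightarrow> 'f tm" where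
  "rename_tm f (Var v) = Var (f v)"
| "rename_tm f (Fun g ts) = Fun g (map (rename_tm f) ts)"

primrec rename :: "(var \<Rightarrow> var) \<Rightarrow> ('f, 'r) fm \<Rightarrow> ('f, 'r) fm" where
  "rename f (Eq s t) = Eq (rename_tm f s) (rename_tm f t)"
| "rename f (Rel r ts) = Rel r (map (rename_tm f) ts)"
| "rename f (RelVar S ts) = RelVar S (map (rename_tm f) ts)"
| "rename f (Neg \<phi>) = Neg (rename f \<phi>)"
| "rename f (Conj \<phi> \<psi>) = Conj (rename f \<phi>) (rename f \<psi>)"
| "rename f (Ex v \<phi>) = Ex (f v) (rename f \<phi>)"
| "rename f (Lfp S xs \<phi> us) = Lfp S (map f xs) (rename f \<phi>) (map f us)"

lemma fv_rename_tm [simp]: "fv_tm (rename_tm f t) = f ` fv_tm t"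
  by (induction t) auto

lemma fv_rename [simp]: "inj f \<Longrightarrow> fv (rename f \<phi>) = f ` fv \<phi>"
  by (induction \<phi>) (auto simp: image_set_diff inj_eq)

lemma wf_rename_tm [simp]: "wf_tm L (rename_tm f t) \<longleftrightarrow> wf_tm L t"
  by (induction t) auto

lemma free_relvars_rename [simp]: "free_relvars (rename f \<phi>) = free_relvars \<phi>"
  by (induction \<phi>) auto

lemma only_polarity_rename [simp]: "only_polarity S p (rename f \<phi>) \<longleftrightarrow> only_polarity S p \<phi>"
  by (induction \<phi> arbitrary: p) auto

text \<open>Injectivity preserves the side conditions on fixed points: distinct variables stay
  distinct and fresh ones stay fresh.\<close>

lemma wf_rename [simp]: "inj f \<Longrightarrow> wf_fm L (rename f \<phi>) \<longleftrightarrow> wf_fm L \<phi>"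
  by (induction \<phi>)
    (auto simp: distinct_map image_Un[symmetric] image_Int[symmetric] simp del: image_Un
      intro: inj_on_subset)

lemma eval_rename_tm [simp]: "eval_tm M e (rename_tm f t) = eval_tm M (e \<circ> f) t"
  by (induction t) (auto cong: map_cong)

lemma upds_rename: "inj f \<Longrightarrow> upds e (map f xs) as \<circ> f = upds (e \<circ> f) xs as"
proof (induction xs arbitrary: as)
  case Nil
  then show ?case by (simp add: upds_def fun_eq_iff)
next
  case (Cons x xs)
  then show ?case
    by (cases as) (auto simp: upds_def fun_eq_iff inj_eq)
qed

lemma sat_rename: "inj f \<Longrightarrow> sat M e R (rename f \<phi>) \<longleftrightarrow> sat M (e \<circ> f) R \<phi>"
proof (induction \<phi> arbitrary: e R)
  case (Ex v \<phi>)
  have "e(f v := a) \<circ> f = (e \<circ> f)(v := a)" for a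
    using Ex.prems by (auto simp: fun_eq_iff inj_eq)
  then show ?case using Ex by (simp del: comp_apply fun_upd_comp)
qed (auto simp: comp_def[of _ "rename_tm f"] upds_rename)

section \<open>Dependence of satisfaction on the free variables only\<close>

lemma eval_tm_cong: "(\<And>v. v \<in> fv_tm t \<Longrightarrow> e v = e' v) \<Longrightarrow> eval_tm M e t = eval_tm M e' t"
proof (induction t)
  case (Fun g ts)
  then have "map (eval_tm M e) ts = map (eval_tm M e') ts" by fastforce
  then show ?case by (simp del: map_eq_conv)
qed simp

lemma upds_cong: "(\<And>v. v \<in> V - set xs \<Longrightarrow> e v = e' v) \<Longrightarrow> length xs = length as \<Longrightarrow> v \<in> V \<Longrightarrow>
  upds e xs as v = upds e' xs as v"
proof (cases "v \<in> set xs")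
  case True
  assume "length xs = length as"
  with True show ?thesis
    by (auto simp: upds_def map_of_zip_is_None split: option.split)
next
  case False
  assume "\<And>v. v \<in> V - set xs \<Longrightarrow> e v = e' v" "v \<in> V"
  moreover from False have "map_of (zip xs as) v = None"
    by (metis map_of_eq_None_iff in_set_zipE imageE prod.collapse)
  ultimately show ?thesis using False by (simp add: upds_def)
qed

text \<open>Well-formedness matters at fixed points: \<open>xs\<close> has the length of the tuple
  \<open>b\<close>, so the update overwrites every bound variable.\<close>

lemma sat_cong:
  "wf_fm L \<phi> \<Longrightarrow> (\<And>v. v \<in> fv \<phi> \<Longrightarrow> e v = e' v) \<Longrightarrow> sat M e R \<phi> \<longleftrightarrow> sat M e' R \<phi>"
proof (induction \<phi> arbitrary: e e' R)
  case (Eq s t)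
  then show ?case using eval_tm_cong[of s e e' M] eval_tm_cong[of t e e' M] by simp
next
  case (Rel r ts)
  then have "map (eval_tm M e) ts = map (eval_tm M e') ts"
    by (auto intro: eval_tm_cong)
  then show ?case by (simp del: map_eq_conv)
next
  case (RelVar S ts)
  then have "map (eval_tm M e) ts = map (eval_tm M e') ts"
    by (auto intro: eval_tm_cong)
  then show ?case by (simp del: map_eq_conv)
next
  case (Neg \<phi>)
  then show ?case by (metis fv.simps(4) sat.simps(4) wf_fm.simps(4))
next
  case (Conj \<phi> \<psi>)
  have "sat M e R \<phi> \<longleftrightarrow> sat M e' R \<phi>" "sat M e R \<psi> \<longleftrightarrow> sat M e' R \<psi>"
    using Conj.prems by (intro Conj.IH; auto)+
  then show ?case by simp
next
  case (Ex v \<phi>)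
  have "sat M (e(v := a)) R \<phi> \<longleftrightarrow> sat M (e'(v := a)) R \<phi>" for a
    using Ex.prems by (intro Ex.IH) auto
  then show ?case by simp
next
  case (Lfp S xs \<phi> us)
  have "sat M (upds e xs b) (R(S := X)) \<phi> \<longleftrightarrow> sat M (upds e' xs b) (R(S := X)) \<phi>"
    if "b \<in> tuples M (arity S)" for b X
    using Lfp.prems that by (intro Lfp.IH upds_cong[where V = "fv \<phi>"]) (auto simp: tuples_def)
  then have "(\<lambda>X. {b \<in> tuples M (arity S). sat M (upds e xs b) (R(S := X)) \<phi>}) =
    (\<lambda>X. {b \<in> tuples M (arity S). sat M (upds e' xs b) (R(S := X)) \<phi>})"
    by (intro ext) blast
  moreover have "map e us = map e' us" using Lfp.prems by simp
  ultimately show ?case by (simp del: map_eq_conv)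
qed

lemma upds_nth:
  "distinct xs \<Longrightarrow> length xs = length as \<Longrightarrow> q < length xs \<Longrightarrow> upds e xs as (xs ! q) = as ! q"
  by (simp add: upds_def map_of_zip_nth)

text \<open>This frees \<open>holds\<close> from its particular assignment, so that reordered or
  renamed assignments can be compared with it.\<close>

lemma sat_cong_holds:
  assumes "wf_fm L \<phi>" "partitioned \<phi> x y" "length a = length x" "length b = length y"
    and "\<And>q. q < length x \<Longrightarrow> e (x ! q) = a ! q"
    and "\<And>q. q < length y \<Longrightarrow> e (y ! q) = b ! q"
  shows "sat M e (\<lambda>_. {}) \<phi> \<longleftrightarrow> holds M \<phi> x y a b"
  unfolding holds_def
proof (rule sat_cong[OF assms(1)])
  fix v assume "v \<in> fv \<phi>"
  then have "v \<in> set (x @ y)" using assms(2) by (auto simp: partitioned_def)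
  then obtain q where q: "q < length (x @ y)" "v = (x @ y) ! q"
    by (metis in_set_conv_nth)
  then have "upds (\<lambda>_. undefined) (x @ y) (a @ b) v = (a @ b) ! q"
    using assms(2-4) by (auto simp: partitioned_def intro!: upds_nth)
  moreover have "e v = (a @ b) ! q"
    using q assms(3-6) by (auto simp: nth_append)
  ultimately show "e v = upds (\<lambda>_. undefined) (x @ y) (a @ b) v" by simp
qed

lemma holds_swap:
  assumes "wf_fm L \<phi>" "partitioned \<phi> x y" "length a = length x" "length b = length y"
  shows "holds M \<phi> y x b a \<longleftrightarrow> holds M \<phi> x y a b"
  unfolding holds_def[of M \<phi> y x]
proof (rule sat_cong_holds[OF assms])
  have d: "distinct (y @ x)" using assms(2) by (auto simp: partitioned_def)
  show "upds (\<lambda>_. undefined) (y @ x) (b @ a) (x ! q) = a ! q" if "q < length x" for q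
    using upds_nth[OF d, of "b @ a" "length y + q"] that assms(3,4) by (simp add: nth_append)
  show "upds (\<lambda>_. undefined) (y @ x) (b @ a) (y ! q) = b ! q" if "q < length y" for q
    using upds_nth[OF d, of "b @ a" q] that assms(3,4) by (simp add: nth_append)
qed

section \<open>Formulas prescribing a truth pattern\<close>

text \<open>The variables \<open>x\<close> are shared by all copies. Any other \<open>v\<close> in
  copy \<open>p\<close> is coded as \<open>v * k + p\<close>, decoded by division by
  \<open>k\<close>, and shifted beyond \<open>x\<close>. Bound variables are renamed too, so the map
  is total on variables. \<open>insert 0\<close> gives \<open>Max\<close> a value for empty
  \<open>x\<close>.\<close>

definition block_var :: "var list \<Rightarrow> nat \<Rightarrow> nat \<Rightarrow> var \<Rightarrow> var" where
  "block_var x k p v = (if v \<in> set x then v else Suc (Max (insert 0 (set x))) + v * k + p)"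

definition blocks :: "var list \<Rightarrow> nat \<Rightarrow> var list \<Rightarrow> var list" where
  "blocks x k y = concat (map (\<lambda>p. map (block_var x k p) y) [0..<k])"

text \<open>This is \<open>\<phi>(x;y\<^sub>i) \<and> \<theta>\<close> of the introduction when \<open>i \<in> J\<close>. The block \<open>i + 1\<close> of parameters
  is a dummy, kept to have a uniform indexing.\<close>

definition pattern_fm :: "var list \<Rightarrow> nat \<Rightarrow> nat set \<Rightarrow> nat \<Rightarrow> ('f, 'r) fm \<Rightarrow> ('f, 'r) fm" where
  "pattern_fm x k J i \<phi> = foldr Conj
     (map (\<lambda>p. if p \<in> J then rename (block_var x k p) \<phi> else Neg (rename (block_var x k p) \<phi>))
       (filter (\<lambda>p. p \<noteq> Suc i) [0..<k]))
     (rename (block_var x k i) \<phi>)"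

lemma block_var_new: "v \<notin> set x \<Longrightarrow> block_var x k p v \<notin> set x"
proof
  assume "v \<notin> set x" "block_var x k p v \<in> set x"
  then have "block_var x k p v \<le> Max (insert 0 (set x))"
    by (intro Max_ge) auto
  with \<open>v \<notin> set x\<close> show False by (simp add: block_var_def)
qed

lemma block_var_eq_iff:
  assumes "p < k" "p' < k" "v \<notin> set x" "v' \<notin> set x"
  shows "block_var x k p v = block_var x k p' v' \<longleftrightarrow> p = p' \<and> v = v'"
proof
  assume "block_var x k p v = block_var x k p' v'"
  then have eq: "v * k + p = v' * k + p'" using assms by (simp add: block_var_def)
  have "(v * k + p) mod k = p" "(v' * k + p') mod k = p'" using assms by auto
  moreover have "(v * k + p) div k = v" "(v' * k + p') div k = v'" using assms by auto
  ultimately show "p = p' \<and> v = v'" using eq by metis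
qed auto

lemma inj_block_var: "p < k \<Longrightarrow> inj (block_var x k p)"
proof (rule injI)
  fix v v' assume "p < k" "block_var x k p v = block_var x k p v'"
  then show "v = v'"
    using block_var_eq_iff[of p k p v x v'] block_var_new[of v x k p] block_var_new[of v' x k p]
    by (cases "v \<in> set x"; cases "v' \<in> set x") (auto simp: block_var_def[of x k p v] block_var_def[of x k p v'])
qed

lemma set_blocks: "set (blocks x k y) = (\<Union>p<k. block_var x k p ` set y)"
  by (auto simp: blocks_def)

lemma distinct_blocks:
  assumes "distinct (x @ y)"
  shows "distinct (x @ blocks x k y)"
proof -
  have y: "v \<notin> set x" if "v \<in> set y" for v using that assms by auto
  \<comment> \<open>The coding depends on \<open>k\<close>, so the induction runs over the number
    \<open>n\<close> of blocks with \<open>k\<close> fixed.\<close>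
  have "distinct (concat (map (\<lambda>p. map (block_var x k p) y) [0..<n]))" if "n \<le> k" for n
    using that
  proof (induction n)
    case (Suc n)
    have "inj_on (block_var x k n) (set y)"
      using Suc.prems inj_block_var inj_on_subset by (metis Suc_le_lessD subset_UNIV)
    then show ?case
      using Suc assms y by (auto simp: distinct_map block_var_eq_iff)
  qed simp
  then have "distinct (blocks x k y)" by (simp add: blocks_def)
  moreover have "set x \<inter> set (blocks x k y) = {}"
    using y block_var_new by (fastforce simp: set_blocks)
  ultimately show ?thesis using assms by simp
qed

lemma length_concat_map_upt:
  "(\<And>p. p < k \<Longrightarrow> length (g p) = m) \<Longrightarrow> length (concat (map g [0..<k])) = k * m"
  by (induction k) auto

lemma nth_concat_map_upt:
  assumes "\<And>p. p < k \<Longrightarrow> length (g p) = m" "p < k" "q < m"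
  shows "concat (map g [0..<k]) ! (p * m + q) = g p ! q"
  using assms
proof (induction k)
  case (Suc k)
  have len: "length (concat (map g [0..<k])) = k * m"
    using Suc.prems(1) by (intro length_concat_map_upt) simp
  show ?case
  proof (cases "p = k")
    case False
    then have "p < k" using Suc.prems by simp
    have "p * m + q < Suc p * m" using Suc.prems(3) by simp
    also have "\<dots> \<le> k * m" using \<open>p < k\<close> by (intro mult_le_mono1) simp
    finally have "p * m + q < k * m" .
    then show ?thesis using Suc \<open>p < k\<close> len by (simp add: nth_append)
  qed (simp add: nth_append len)
qed simp

lemma sat_foldr_Conj:
  "sat M e R (foldr Conj \<phi>s \<psi>) \<longleftrightarrow> (\<forall>\<phi>\<in>set \<phi>s. sat M e R \<phi>) \<and> sat M e R \<psi>"
  by (induction \<phi>s) auto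

lemma wf_foldr_Conj:
  "wf_fm L (foldr Conj \<phi>s \<psi>) \<longleftrightarrow> (\<forall>\<phi>\<in>set \<phi>s. wf_fm L \<phi>) \<and> wf_fm L \<psi>"
  by (induction \<phi>s) auto

lemma fv_foldr_Conj: "fv (foldr Conj \<phi>s \<psi>) = \<Union> (fv ` set \<phi>s) \<union> fv \<psi>"
  by (induction \<phi>s) auto

lemma free_relvars_foldr_Conj:
  "free_relvars (foldr Conj \<phi>s \<psi>) = \<Union> (free_relvars ` set \<phi>s) \<union> free_relvars \<psi>"
  by (induction \<phi>s) auto

lemma LFP_formula_pattern_fm:
  "LFP_formula L \<phi> \<Longrightarrow> i < k \<Longrightarrow> LFP_formula L (pattern_fm x k J i \<phi>)"
  by (auto simp: LFP_formula_def pattern_fm_def wf_foldr_Conj free_relvars_foldr_Conj inj_block_var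
    split: if_splits)

lemma partitioned_pattern_fm:
  assumes "partitioned \<phi> x y" "i < k"
  shows "partitioned (pattern_fm x k J i \<phi>) x (blocks x k y)"
proof -
  have "fv (rename (block_var x k p) \<phi>) \<subseteq> set x \<union> set (blocks x k y)" if "p < k" for p
  proof -
    have "block_var x k p v = v" if "v \<in> set x" for v using that by (simp add: block_var_def)
    then show ?thesis
      using assms(1) \<open>p < k\<close> by (fastforce simp: partitioned_def inj_block_var set_blocks)
  qed
  then have "fv (pattern_fm x k J i \<phi>) \<subseteq> set x \<union> set (blocks x k y)"
    using assms(2) by (auto simp: pattern_fm_def fv_foldr_Conj split: if_splits)
  then show ?thesis
    using assms(1) distinct_blocks by (auto simp: partitioned_def)
qed

text \<open>The copy at \<open>i\<close> closes the conjunction in place of a constant for truth;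
  since \<open>i \<in> J\<close>, it agrees with what the pattern demands at
  \<open>i\<close>.\<close>

lemma holds_pattern_fm:
  assumes wf: "wf_fm L \<phi>" and part: "partitioned \<phi> x y" and a: "length a = length x"
    and \<beta>: "\<And>p. p < k \<Longrightarrow> length (\<beta> p) = length y" and i: "i \<in> J" "i < k"
  shows "holds M (pattern_fm x k J i \<phi>) x (blocks x k y) a (concat (map \<beta> [0..<k])) \<longleftrightarrow>
    (\<forall>p<k. p \<noteq> Suc i \<longrightarrow> (holds M \<phi> x y a (\<beta> p) \<longleftrightarrow> p \<in> J))"
proof -
  let ?b = "concat (map \<beta> [0..<k])"
  let ?e = "upds (\<lambda>_. undefined) (x @ blocks x k y) (a @ ?b)"
  have d: "distinct (x @ blocks x k y)"
    using part distinct_blocks by (auto simp: partitioned_def)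
  have len: "length (blocks x k y) = k * length y" "length ?b = k * length y"
    using \<beta> by (auto simp: blocks_def intro: length_concat_map_upt)
  have block: "sat M ?e (\<lambda>_. {}) (rename (block_var x k p) \<phi>) \<longleftrightarrow> holds M \<phi> x y a (\<beta> p)"
    if p: "p < k" for p
    unfolding sat_rename[OF inj_block_var[OF p]]
  proof (rule sat_cong_holds[OF wf part a \<beta>[OF p]])
    show "(?e \<circ> block_var x k p) (x ! q) = a ! q" if "q < length x" for q
      using upds_nth[OF d, of "a @ ?b" q] that a len by (simp add: nth_append block_var_def)
    show "(?e \<circ> block_var x k p) (y ! q) = \<beta> p ! q" if q: "q < length y" for q
    proof -
      \<comment> \<open>Entry \<open>q\<close> of block \<open>p\<close> has offset
        \<open>p * length y + q\<close>, which must stay below the total length.\<close>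
      have "p * length y + q < Suc p * length y" using q by simp
      also have "\<dots> \<le> k * length y" using p by (intro mult_le_mono1) simp
      finally have lt: "p * length y + q < k * length y" .
      have "blocks x k y ! (p * length y + q) = block_var x k p (y ! q)"
        using nth_concat_map_upt[of k "\<lambda>p. map (block_var x k p) y" "length y" p q] p q
        by (simp add: blocks_def)
      moreover have "?b ! (p * length y + q) = \<beta> p ! q"
        using nth_concat_map_upt[of k \<beta> "length y" p q] p q \<beta> by simp
      ultimately show ?thesis
        using upds_nth[OF d, of "a @ ?b" "length x + (p * length y + q)"] a len lt
        by (simp add: nth_append)
    qed
  qed
  have sat_pattern: "holds M (pattern_fm x k J i \<phi>) x (blocks x k y) a ?b \<longleftrightarrow>
    sat M ?e (\<lambda>_. {}) (pattern_fm x k J i \<phi>)"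
    by (rule holds_def)
  have "sat M ?e (\<lambda>_. {}) (pattern_fm x k J i \<phi>) \<longleftrightarrow>
    (\<forall>p<k. p \<noteq> Suc i \<longrightarrow> (holds M \<phi> x y a (\<beta> p) \<longleftrightarrow> p \<in> J)) \<and> holds M \<phi> x y a (\<beta> i)"
    using i(2) by (auto simp: pattern_fm_def sat_foldr_Conj block simp del: if_image_distrib)
  with sat_pattern show ?thesis using i by auto
qed

section \<open>The order property, the strict order property and the independence property\<close>

text \<open>Each of the \<open>n\<close> strict inclusions among \<open>Suc n\<close> sets provides
  a point \<open>a i\<close> in the set of \<open>b (Suc i)\<close> but not in that of
  \<open>b i\<close>. Monotonicity decides all other memberships.\<close>

lemma OP_if_sOP:
  assumes "sOP M \<phi> x y (Suc n)"
  shows "OP M \<phi> x y n"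
proof -
  let ?S = "\<lambda>b. solutions M \<phi> x y b"
  obtain b where b: "\<forall>j\<in>{1..Suc n}. b j \<in> tuples M (length y)"
    and inc: "\<forall>j\<in>{1..<Suc n}. ?S (b j) \<subset> ?S (b (Suc j))"
    using assms unfolding sOP_def by (elim exE conjE)
  have mono: "?S (b i) \<subseteq> ?S (b j)" if "1 \<le> i" "i \<le> j" "j \<le> Suc n" for i j
    using that(2,1,3)
  proof (induction j rule: dec_induct)
    case (step m)
    then show ?case using inc[rule_format, of m] by auto
  qed simp
  have "\<forall>i\<in>{1..n}. \<exists>a. a \<in> ?S (b (Suc i)) - ?S (b i)"
    using inc by fastforce
  then obtain a where a: "\<And>i. i \<in> {1..n} \<Longrightarrow> a i \<in> ?S (b (Suc i)) - ?S (b i)"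
    by metis
  have "a i \<in> ?S (b j) \<longleftrightarrow> i < j" if ij: "i \<in> {1..n}" "j \<in> {1..n}" for i j
  proof (cases "i < j")
    case True
    then show ?thesis using mono[of "Suc i" j] a[of i] ij by auto
  next
    case False
    then show ?thesis using mono[of j i] a[of i] ij by auto
  qed
  moreover have aM: "a i \<in> tuples M (length x)" if "i \<in> {1..n}" for i
    using a[OF that] by (simp add: solutions_def)
  ultimately have "\<forall>i\<in>{1..n}. \<forall>j\<in>{1..n}. holds M \<phi> x y (a i) (b j) \<longleftrightarrow> i < j"
    by (simp add: solutions_def)
  with aM b show ?thesis unfolding OP_def by (intro exI[of _ a] exI[of _ b]) auto
qed

text \<open>The initial segments \<open>{1..<j}\<close> are among the independent patterns, and
  \<open>i\<close> belongs to such a segment exactly when \<open>i < j\<close>.\<close>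

lemma OP_if_IP:
  assumes "IP M \<phi> x y n"
  shows "OP M \<phi> x y n"
proof -
  obtain a b where "\<forall>i\<in>{1..n}. a i \<in> tuples M (length x)"
    "\<forall>J\<in>Pow {1..n}. b J \<in> tuples M (length y)"
    "\<forall>i\<in>{1..n}. \<forall>J\<in>Pow {1..n}. holds M \<phi> x y (a i) (b J) \<longleftrightarrow> i \<in> J"
    using assms unfolding IP_def by (elim exE conjE)
  moreover have "{1..<j} \<in> Pow {1..n}" if "j \<in> {1..n}" for j :: nat
    using that by auto
  ultimately show ?thesis
    unfolding OP_def by (intro exI[of _ a] exI[of _ "\<lambda>j. b {1..<j}"]) simp
qed

lemma sOP_mono: "sOP M \<phi> x y n \<Longrightarrow> m \<le> n \<Longrightarrow> sOP M \<phi> x y m"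
  unfolding sOP_def by (erule ex_forward) auto

section \<open>Order without independence yields strict order\<close>

text \<open>If every pattern were realised on \<open>c\<close>, the entries of \<open>c\<close> as
  points and the realising tuples as parameters would give independence of the opposite
  formula.\<close>

lemma unrealised_pattern_if_not_IP:
  assumes wf: "wf_fm L \<phi>" "partitioned \<phi> x y" and "\<not> IP M \<phi> y x k"
    and c: "\<And>p. p < k \<Longrightarrow> c p \<in> tuples M (length y)"
  shows "\<exists>J\<subseteq>{..<k}. \<forall>u\<in>tuples M (length x). \<not> (\<forall>p<k. holds M \<phi> x y u (c p) \<longleftrightarrow> p \<in> J)"
proof (rule ccontr)
  assume "\<not> ?thesis"
  then have "\<forall>J\<in>Pow {..<k}. \<exists>u. u \<in> tuples M (length x) \<and>
      (\<forall>p<k. holds M \<phi> x y u (c p) \<longleftrightarrow> p \<in> J)"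
    by auto
  from bchoice[OF this] obtain u where uM: "\<And>J. J \<subseteq> {..<k} \<Longrightarrow> u J \<in> tuples M (length x)"
    and u: "\<And>J p. J \<subseteq> {..<k} \<Longrightarrow> p < k \<Longrightarrow> holds M \<phi> x y (u J) (c p) \<longleftrightarrow> p \<in> J"
    by blast
  \<comment> \<open>Positions run from 0 to \<open>k - 1\<close> but the points of \<open>IP\<close>
    from 1 to \<open>k\<close>; \<open>pre\<close> shifts a pattern down by one.\<close>
  define pre where "pre J = {p. p < k \<and> Suc p \<in> J}" for J
  have pre: "pre J \<subseteq> {..<k}" for J by (auto simp: pre_def)
  have "holds M \<phi> y x (c (i - 1)) (u (pre J)) \<longleftrightarrow> i \<in> J"
    if "i \<in> {1..k}" "J \<in> Pow {1..k}" for i J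
  proof -
    have i: "i - 1 < k" "Suc (i - 1) = i" using that by auto
    have "holds M \<phi> y x (c (i - 1)) (u (pre J)) \<longleftrightarrow> holds M \<phi> x y (u (pre J)) (c (i - 1))"
      using uM[OF pre] c[OF i(1)] by (intro holds_swap[OF wf]) (auto simp: tuples_def)
    also have "\<dots> \<longleftrightarrow> i \<in> J" using u[OF pre i(1)] i by (simp add: pre_def)
    finally show ?thesis .
  qed
  moreover have "c (i - 1) \<in> tuples M (length y)" if "i \<in> {1..k}" for i
    using c that by auto
  ultimately have "IP M \<phi> y x k"
    unfolding IP_def using uM[OF pre]
    by (intro exI[of _ "\<lambda>i. c (i - 1)"] exI[of _ "\<lambda>J. u (pre J)"]) auto
  with assms(3) show False by simp
qed

text \<open>The \<open>k\<close> parameters of a stage of the chain are concatenated into one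
  parameter of \<open>pattern_fm\<close>. The bound \<open>n\<close> serves all structures, whereas
  \<open>J\<close> and \<open>i\<close> may depend on \<open>M\<close>.\<close>

lemma sOP_pattern_fm_if_OP:
  fixes k N :: nat and \<phi> :: "('f, 'r) fm"
  assumes wf: "wf_fm L \<phi>" "partitioned \<phi> x y"
  shows "\<exists>n. \<forall>M :: ('f, 'r, 'a) struct. OP M \<phi> x y n \<longrightarrow> \<not> IP M \<phi> y x k \<longrightarrow>
    (\<exists>J\<subseteq>{..<k}. \<exists>i<k. sOP M (pattern_fm x k J i \<phi>) x (blocks x k y) N)"
proof (rule ex_forward[OF order_chain_from_missing_pattern
      [where ?'a = "'a list" and ?'b = "'a list" and k = k and N = N]], goal_cases)
  case n: (1 n)
  show ?case
  proof (intro allI impI)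
    fix M :: "('f, 'r, 'a) struct"
    assume "OP M \<phi> x y n" and nIP: "\<not> IP M \<phi> y x k"
    then obtain a b where aM: "\<forall>i\<in>{1..n}. a i \<in> tuples M (length x)"
      and bM: "\<forall>j\<in>{1..n}. b j \<in> tuples M (length y)"
      and ab: "\<forall>i\<in>{1..n}. \<forall>j\<in>{1..n}. holds M \<phi> x y (a i) (b j) \<longleftrightarrow> i < j"
      by (auto simp: OP_def)
    have "\<forall>c. (\<forall>p<k. c p \<in> {1..n}) \<longrightarrow> (\<exists>J\<subseteq>{..<k}. \<forall>u\<in>tuples M (length x).
        \<not> (\<forall>p<k. holds M \<phi> x y u (b (c p)) \<longleftrightarrow> p \<in> J))"
      using bM by (intro allI impI unrealised_pattern_if_not_IP[OF wf nIP]) blast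
    from n[THEN spec, THEN spec, THEN spec, THEN spec, THEN mp, OF aM, THEN mp, OF ab,
        THEN mp, OF this]
    obtain J i \<beta> where J: "J \<subseteq> {..<k}" "i \<in> J" "Suc i < k"
      and \<beta>b: "\<forall>j p. j \<in> {1..N} \<longrightarrow> p < k \<longrightarrow> \<beta> j p \<in> b ` {1..n}"
      and inc: "\<forall>j\<in>{1..<N}.
        {u\<in>tuples M (length x). \<forall>p<k. p \<noteq> Suc i \<longrightarrow> (holds M \<phi> x y u (\<beta> j p) \<longleftrightarrow> p \<in> J)} \<subset>
        {u\<in>tuples M (length x). \<forall>p<k. p \<noteq> Suc i \<longrightarrow> (holds M \<phi> x y u (\<beta> (Suc j) p) \<longleftrightarrow> p \<in> J)}"
      by (elim exE conjE)
    have i: "i < k" using J by simp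
    define B where "B j = concat (map (\<beta> j) [0..<k])" for j
    have \<beta>M: "\<beta> j p \<in> tuples M (length y)" if "j \<in> {1..N}" "p < k" for j p
    proof -
      have "\<beta> j p \<in> b ` {1..n}" using \<beta>b that by simp
      then show ?thesis using bM by auto
    qed
    have len: "length (\<beta> j p) = length y" if "j \<in> {1..N}" "p < k" for j p
      using \<beta>M[OF that] by (simp add: tuples_def)
    have "B j \<in> tuples M (length (blocks x k y))" if "j \<in> {1..N}" for j
    proof -
      have "length (B j) = k * length y" "length (blocks x k y) = k * length y"
        using len that by (auto simp: B_def blocks_def intro!: length_concat_map_upt)
      moreover have "set (B j) \<subseteq> universe M"
        using \<beta>M[OF that] by (fastforce simp: B_def tuples_def)
      ultimately show ?thesis by (simp add: tuples_def)
    qed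
    moreover have "solutions M (pattern_fm x k J i \<phi>) x (blocks x k y) (B j) =
      {u\<in>tuples M (length x). \<forall>p<k. p \<noteq> Suc i \<longrightarrow> (holds M \<phi> x y u (\<beta> j p) \<longleftrightarrow> p \<in> J)}"
      if "j \<in> {1..N}" for j
    proof -
      have "holds M (pattern_fm x k J i \<phi>) x (blocks x k y) u (B j) \<longleftrightarrow>
        (\<forall>p<k. p \<noteq> Suc i \<longrightarrow> (holds M \<phi> x y u (\<beta> j p) \<longleftrightarrow> p \<in> J))"
        if "u \<in> tuples M (length x)" for u
        unfolding B_def using that len[OF \<open>j \<in> {1..N}\<close>] J(2) i
        by (intro holds_pattern_fm[OF wf]) (auto simp: tuples_def)
      then show ?thesis unfolding solutions_def by blast
    qed
    ultimately have "sOP M (pattern_fm x k J i \<phi>) x (blocks x k y) N"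
      unfolding sOP_def using inc by (intro exI[of _ B]) auto
    with J(1) i show "\<exists>J\<subseteq>{..<k}. \<exists>i<k. sOP M (pattern_fm x k J i \<phi>) x (blocks x k y) N"
      by blast
  qed
qed

text \<open>The pair \<open>(J, i)\<close> may vary with \<open>N\<close>, but \<open>k\<close> is
  fixed and leaves only finitely many pairs, so one of them works for all \<open>N\<close> by
  pigeonhole.\<close>

lemma LFP_has_sOP_if_OP:
  fixes C :: "('f, 'r, 'a) struct set"
  assumes "LFP_has OP L C" and "\<not> LFP_has IP L C"
  shows "LFP_has sOP L C"
proof -
  obtain \<phi> x y where \<phi>: "LFP_formula L \<phi>" "partitioned \<phi> x y" and OP: "\<And>n. \<exists>M\<in>C. OP M \<phi> x y n"
    using assms(1) by (auto simp: LFP_has_def)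
  have wf: "wf_fm L \<phi>" using \<phi> by (simp add: LFP_formula_def)
  \<comment> \<open>Without \<open>LFP_has IP\<close>, the opposite formula fails to be independent
    at a single \<open>k\<close> in all members of \<open>C\<close> at once.\<close>
  have "partitioned \<phi> y x" using \<phi>(2) by (auto simp: partitioned_def)
  then obtain k where k: "\<And>M. M \<in> C \<Longrightarrow> \<not> IP M \<phi> y x k"
    using assms(2) \<phi>(1) unfolding LFP_has_def by blast
  let ?P = "\<lambda>M z. sOP M (pattern_fm x k (fst z) (snd z) \<phi>) x (blocks x k y)"
  have sOP: "\<exists>M\<in>C. \<exists>z\<in>Pow {..<k} \<times> {..<k}. ?P M z N" for N
  proof -
    obtain n where n: "\<forall>M :: ('f, 'r, 'a) struct. OP M \<phi> x y n \<longrightarrow> \<not> IP M \<phi> y x k \<longrightarrow>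
      (\<exists>J\<subseteq>{..<k}. \<exists>i<k. sOP M (pattern_fm x k J i \<phi>) x (blocks x k y) N)"
      using sOP_pattern_fm_if_OP[OF wf \<phi>(2)] by (rule exE)
    obtain M where "M \<in> C" "OP M \<phi> x y n" using OP by blast
    with n k show ?thesis by fastforce
  qed
  have "\<exists>z\<in>Pow {..<k} \<times> {..<k}. \<forall>N. \<exists>M\<in>C. ?P M z N"
  proof (rule ccontr)
    assume "\<not> ?thesis"
    then have "\<forall>z\<in>Pow {..<k} \<times> {..<k}. \<exists>N. \<forall>M\<in>C. \<not> ?P M z N" by blast
    from bchoice[OF this] obtain N where N: "\<And>z M. z \<in> Pow {..<k} \<times> {..<k} \<Longrightarrow> M \<in> C \<Longrightarrow> \<not> ?P M z (N z)"
      by blast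
    \<comment> \<open>If each pair \<open>z\<close> failed at its own \<open>N z\<close>, a chain as
      long as the maximum of these could be cut down by \<open>sOP_mono\<close> to one of length
      \<open>N z\<close>.\<close>
    obtain M z where Mz: "M \<in> C" "z \<in> Pow {..<k} \<times> {..<k}"
      "?P M z (Max (N ` (Pow {..<k} \<times> {..<k})))"
      using sOP by blast
    have "N z \<le> Max (N ` (Pow {..<k} \<times> {..<k}))"
      using Mz(2) by (intro Max_ge) auto
    with Mz N show False using sOP_mono by blast
  qed
  then obtain J i where "i < k" "\<And>N. \<exists>M\<in>C. sOP M (pattern_fm x k J i \<phi>) x (blocks x k y) N"
    by auto
  with LFP_formula_pattern_fm[OF \<phi>(1)] partitioned_pattern_fm[OF \<phi>(2)] show ?thesis
    unfolding LFP_has_def by blast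
qed

theorem theorem3p8:
  fixes L :: "('f, 'r) signature"
    and C :: "('f, 'r, 'a) struct set"
  assumes "\<forall>M \<in> C. is_finite_struct L M"
  shows "LFP_has OP L C \<longleftrightarrow> LFP_has sOP L C \<or> LFP_has IP L C"
proof
  assume "LFP_has OP L C"
  then show "LFP_has sOP L C \<or> LFP_has IP L C"
    using LFP_has_sOP_if_OP by blast
next
  assume "LFP_has sOP L C \<or> LFP_has IP L C"
  \<comment> \<open>The same formula and partition serve: \<open>OP\<close> at \<open>n\<close>
    comes from \<open>sOP\<close> at \<open>Suc n\<close> or from \<open>IP\<close> at
    \<open>n\<close>.\<close>
  then show "LFP_has OP L C"
    unfolding LFP_has_def using OP_if_sOP OP_if_IP by metis
qed

end
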